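(* Let $p$ be the L tromino. If $P$ is a $(p,2)$-prismatic polyomino with width $w$ and height $h$, then $|P|=13$ and $w\le 5$, $h\le5$.
   Context: Cells are the unit squares of the square lattice, indexed by integer coordinates $(x,y)$. A polyomino is a finite nonempty edge-connected set of cells; its size $|P|$ is its number of cells; its width (resp. height) is the number of columns (resp. rows) occupied by its cells; polyominoes are considered up to translation. The L tromino is $\{(0,0),(1,0),(0,1)\}$ (only this orientation). An $n$-coloring assigns each cell a color in $\{1,\dots,n\}$. An instance of a shape is a translate of it; an instance contained in a colored set is colored by restriction, and two instances have the same coloring if the colorings agree under the translation. A de Bruijn polyomino for $(p,n)$ is an $n$-colored polyomino containing exactly one instance of each of the $n^{|p|}$ distinct $n$-colorings of $p$; a $(p,n)$-prismatic polyomino is a de Bruijn polyomino for $(p,n)$ of minimum size. *)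

theory Defs
  imports "HOL-Library.FuncSet" "HOL-Library.Product_Plus"
begin

type_synonym cell = "int \<times> int"

definition edge_adjacent :: "cell \<Rightarrow> cell \<Rightarrow> bool" where
  "edge_adjacent a b \<longleftrightarrow> \<bar>fst a - fst b\<bar> + \<bar>snd a - snd b\<bar> = 1"

definition edge_connected :: "cell set \<Rightarrow> bool" where
  "edge_connected A \<longleftrightarrow>
     (\<forall>a\<in>A. \<forall>b\<in>A. (\<lambda>u v. u \<in> A \<and> v \<in> A \<and> edge_adjacent u v)\<^sup>*\<^sup>* a b)"

definition polyomino :: "cell set \<Rightarrow> bool" where
  "polyomino A \<longleftrightarrow> finite A \<and> A \<noteq> {} \<and> edge_connected A"

definition width :: "cell set \<Rightarrow> nat" where
  "width A = card (fst ` A)"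

definition height :: "cell set \<Rightarrow> nat" where
  "height A = card (snd ` A)"

definition L_tromino :: "cell set" where
  "L_tromino = {(0, 0), (1, 0), (0, 1)}"

text \<open>Colorings are extensional functions, so that distinct elements of
  \<open>colorings n A\<close> differ on \<open>A\<close>, and there are \<open>n ^ card A\<close> of them for finite \<open>A\<close>.\<close>

definition colorings :: "nat \<Rightarrow> cell set \<Rightarrow> (cell \<Rightarrow> nat) set" where
  "colorings n A = A \<rightarrow>\<^sub>E {1..n}"

text \<open>\<open>Q\<close> is a translate of the shape \<open>p\<close>, and under this translation the restriction to
  \<open>Q\<close> of the coloring \<open>f\<close> is the coloring \<open>g\<close> of \<open>p\<close>.\<close>

definition instance_with_coloring ::
    "cell set \<Rightarrow> (cell \<Rightarrow> nat) \<Rightarrow> (cell \<Rightarrow> nat) \<Rightarrow> cell set \<Rightarrow> bool" where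
  "instance_with_coloring p g f Q \<longleftrightarrow>
     (\<exists>v. Q = (+) v ` p \<and> (\<forall>c\<in>p. f (v + c) = g c))"

text \<open>A colored polyomino is given by its set \<open>P\<close> of cells together with a coloring \<open>f\<close> of
  \<open>P\<close>.\<close>

definition de_bruijn_polyomino ::
    "cell set \<Rightarrow> nat \<Rightarrow> cell set \<Rightarrow> (cell \<Rightarrow> nat) \<Rightarrow> bool" where
  "de_bruijn_polyomino p n P f \<longleftrightarrow>
     polyomino P \<and> f \<in> colorings n P \<and>
     (\<forall>g\<in>colorings n p. \<exists>!Q. Q \<subseteq> P \<and> instance_with_coloring p g f Q)"

definition prismatic_polyomino ::
    "cell set \<Rightarrow> nat \<Rightarrow> cell set \<Rightarrow> (cell \<Rightarrow> nat) \<Rightarrow> bool" where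
  "prismatic_polyomino p n P f \<longleftrightarrow>
     de_bruijn_polyomino p n P f \<and>
     (\<forall>P' f'. de_bruijn_polyomino p n P' f' \<longrightarrow> card P \<le> card P')"

end

theory Submission
  imports Defs
begin

text \<open>Let \<open>V\<close> be the set of corners of the L trominoes \<open>T\<close> contained in \<open>P\<close>; a de Bruijn polyomino
  has \<open>\<bar>V\<bar> \<ge> 8\<close>, and \<open>V + T \<subseteq> P\<close>. Each nonempty column of \<open>V + T\<close> is larger than the
  column of \<open>V\<close> at the same place, so \<open>\<bar>V + T\<bar>\<close> is at least \<open>\<bar>V\<bar>\<close> plus the number of columns of
  \<open>V + T\<close>. The same holds for rows and, since a shear permutes the three sides of \<open>T\<close>, for
  antidiagonals. If \<open>\<bar>V + T\<bar> < 13\<close>, then \<open>V\<close> meets at most three lines of each of the three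
  directions, which is impossible for eight points. An explicit example shows that 13 is attained;
  then \<open>P = V + T\<close>, and the inequality leaves at most five columns and five rows.\<close>

section \<open>Translates and sumsets of finite sets\<close>

lemma translate_eq_int:
  fixes F :: "int set"
  assumes "finite F" "F \<noteq> {}" "(+) a ` F = (+) b ` F"
  shows "a = b"
proof -
  \<comment> \<open>The sum of the elements detects the translation, because \<open>card F\<close>
    is nonzero.\<close>
  have *: "\<Sum>((+) c ` F) = int (card F) * c + \<Sum>F" for c
    by (simp add: sum.reindex sum.distrib)
  have "int (card F) * a + \<Sum>F = int (card F) * b + \<Sum>F"
    using * assms(3) by metis
  then show ?thesis
    using assms by simp
qed

lemma translate_eq_cell:
  fixes F :: "cell set"
  assumes "finite F" "F \<noteq> {}" "(+) a ` F = (+) b ` F"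
  shows "a = b"
proof (rule prod_eqI)
  have "(+) (fst a) ` fst ` F = fst ` ((+) a ` F)" for a
    by (auto simp: image_image)
  then show "fst a = fst b"
    using assms by (intro translate_eq_int[of "fst ` F"]) auto
  have "(+) (snd a) ` snd ` F = snd ` ((+) a ` F)" for a
    by (auto simp: image_image)
  then show "snd a = snd b"
    using assms by (intro translate_eq_int[of "snd ` F"]) auto
qed

lemma card_less_card_Un:
  assumes "finite A" "finite B" "card A = card B" "A \<noteq> B"
  shows "card A < card (A \<union> B)"
proof -
  have "\<not> B \<subseteq> A"
    using card_subset_eq[OF assms(1), of B] assms(3,4) by auto
  then have "A \<subset> A \<union> B"
    by blast
  then show ?thesis
    using assms by (intro psubset_card_mono) auto
qed

lemma card_translates_cell:
  fixes F :: "cell set"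
  assumes "finite F" "F \<noteq> {}" "a \<noteq> b"
  shows "card F < card ((+) a ` F \<union> (+) b ` F)"
  using card_less_card_Un[of "(+) a ` F" "(+) b ` F"] translate_eq_cell[of F a b] assms
  by (auto simp: card_image)

lemma card_translates_int:
  fixes F :: "int set"
  assumes "finite F" "F \<noteq> {}" "a \<noteq> b"
  shows "card F < card ((+) a ` F \<union> (+) b ` F)"
  using card_less_card_Un[of "(+) a ` F" "(+) b ` F"] translate_eq_int[of F a b] assms
  by (auto simp: card_image)

text \<open>On each line \<pi> = x met by \<open>S\<close>, \<open>S\<close> has at least one cell
  more than the matching line of \<open>V\<close>; summing over the lines gives the bound. An
  arbitrary additive \<pi> covers columns, rows and antidiagonals at once: \<open>u\<close> and
  \<open>v\<close> are the two cells of the tromino on a common line, \<open>w\<close> is the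
  third.\<close>

lemma card_sumset_fibres:
  fixes V :: "cell set" and \<pi> :: "cell \<Rightarrow> int" and u v w :: cell
  defines "S \<equiv> (+) u ` V \<union> (+) v ` V \<union> (+) w ` V"
  assumes fin: "finite V" and add: "\<And>x y. \<pi> (x + y) = \<pi> x + \<pi> y"
    and "u \<noteq> v" "\<pi> u = \<pi> v"
  shows "card V + card (\<pi> ` S) \<le> card S"
proof -
  have finS: "finite S"
    using fin by (simp add: S_def)
  \<comment> \<open>The offset \<open>\<pi> u\<close> makes the translates of \<open>F x\<close> by
    \<open>u\<close> and by \<open>v\<close> both land in \<open>G x\<close>.\<close>
  define F where "F x = {c \<in> V. \<pi> u + \<pi> c = x}" for x
  define G where "G x = {c \<in> S. \<pi> c = x}" for x
  have "F x \<subseteq> V" for x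
    by (auto simp: F_def)
  then have finF: "finite (F x)" for x
    using fin finite_subset by blast
  have finG: "finite (G x)" for x
    using finS by (simp add: G_def)
  have fibre: "card (F x) + 1 \<le> card (G x)" if "x \<in> \<pi> ` S" for x
  proof (cases "F x = {}")
    \<comment> \<open>Such a line is reached only by the translate by \<open>w\<close>, which still
      supplies one cell.\<close>
    case True
    have "G x \<noteq> {}"
      using that by (auto simp: G_def)
    then have "0 < card (G x)"
      using finG by (simp add: card_gt_0_iff)
    then show ?thesis
      using True by simp
  next
    case False
    have "(+) u ` F x \<union> (+) v ` F x \<subseteq> G x"
      using \<open>\<pi> u = \<pi> v\<close> by (auto simp: F_def G_def S_def add)
    then have "card ((+) u ` F x \<union> (+) v ` F x) \<le> card (G x)"
      using finG by (rule card_mono[rotated])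
    then show ?thesis
      using card_translates_cell[OF finF False \<open>u \<noteq> v\<close>] by simp
  qed
  have "V = (\<Union>x\<in>\<pi> ` S. F x)"
    using add by (auto simp: F_def S_def)
  then have "card V = card (\<Union>x\<in>\<pi> ` S. F x)"
    by (rule arg_cong)
  also have "\<dots> = (\<Sum>x\<in>\<pi> ` S. card (F x))"
    using finS finF by (intro card_UN_disjoint) (auto simp: F_def)
  finally have V: "card V = (\<Sum>x\<in>\<pi> ` S. card (F x))" .
  have "S = (\<Union>x\<in>\<pi> ` S. G x)"
    by (auto simp: G_def)
  then have "card S = card (\<Union>x\<in>\<pi> ` S. G x)"
    by (rule arg_cong)
  also have "\<dots> = (\<Sum>x\<in>\<pi> ` S. card (G x))"
    using finS finG by (intro card_UN_disjoint) (auto simp: G_def)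
  finally have S: "card S = (\<Sum>x\<in>\<pi> ` S. card (G x))" .
  have "(\<Sum>x\<in>\<pi> ` S. card (F x) + 1) \<le> (\<Sum>x\<in>\<pi> ` S. card (G x))"
    using fibre by (rule sum_mono)
  then show ?thesis
    using V S by (simp only: sum.distrib card_eq_sum)
qed

lemma card_sumset_projection:
  fixes V :: "cell set" and \<pi> :: "cell \<Rightarrow> int" and u v w :: cell
  assumes "finite V" "V \<noteq> {}" and add: "\<And>x y. \<pi> (x + y) = \<pi> x + \<pi> y"
    and "\<pi> w \<noteq> \<pi> u"
  shows "card (\<pi> ` V) < card (\<pi> ` ((+) u ` V \<union> (+) v ` V \<union> (+) w ` V))"
proof -
  have "card (\<pi> ` V) < card ((+) (\<pi> u) ` \<pi> ` V \<union> (+) (\<pi> w) ` \<pi> ` V)"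
    using assms by (intro card_translates_int) auto
  also have "\<dots> \<le> card (\<pi> ` ((+) u ` V \<union> (+) v ` V \<union> (+) w ` V))"
    using assms by (intro card_mono) (auto simp: image_image image_Un)
  finally show ?thesis .
qed

section \<open>Eight points on parallel lines\<close>

lemma card_3_int_ordered:
  fixes A :: "int set"
  assumes "card A = 3"
  obtains a b c where "a < b" "b < c" "A = {a, b, c}"
proof -
  obtain x y z where *: "A = {x, y, z}" "x \<noteq> y" "y \<noteq> z" "x \<noteq> z"
    using assms by (auto simp: card_3_iff)
  consider "x < y" "y < z" | "x < z" "z < y" | "y < x" "x < z" | "y < z" "z < x"
    | "z < x" "x < y" | "z < y" "y < x"
    using * by linarith
  then show thesis
    by cases ((rule that, assumption, assumption, use * in auto)+)
qed

text \<open>Otherwise \<open>V\<close> is a 3 by 3 grid with at most one point missing, and a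
  monotone path of five grid points already has five different coordinate sums.\<close>

lemma four_parallel_lines:
  fixes V :: "cell set"
  assumes "finite V" "8 \<le> card V"
  shows "4 \<le> card (fst ` V) \<or> 4 \<le> card (snd ` V) \<or> 4 \<le> card ((\<lambda>c. fst c + snd c) ` V)"
proof (rule ccontr)
  define A B where "A = fst ` V" and "B = snd ` V"
  let ?\<sigma> = "\<lambda>c::cell. fst c + snd c"
  assume "\<not> ?thesis"
  then have le: "card A \<le> 3" "card B \<le> 3" and diag: "card (?\<sigma> ` V) \<le> 3"
    by (auto simp: A_def B_def)
  have V: "V \<subseteq> A \<times> B" and fin: "finite (A \<times> B)"
    using assms by (force simp: A_def B_def)+
  then have "8 \<le> card A * card B"
    using assms card_mono[OF fin V] by (simp add: card_cartesian_product)
  \<comment> \<open>A side of length at most 2 would leave at most 6 grid points.\<close>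
  moreover have "card A * card B \<le> 3 * card B" "card A * card B \<le> card A * 3"
    using le by auto
  ultimately have "card A = 3" "card B = 3"
    using le by linarith+
  then obtain a1 a2 a3 b1 b2 b3
    where a: "a1 < a2" "a2 < a3" "A = {a1, a2, a3}" and b: "b1 < b2" "b2 < b3" "B = {b1, b2, b3}"
    by (metis card_3_int_ordered)
  \<comment> \<open>Up the first column, then along the last row: the coordinate sum increases
    strictly.\<close>
  define W where "W = {(a1, b1), (a1, b2), (a1, b3), (a2, b3), (a3, b3)}"
  have W: "W \<subseteq> A \<times> B" "card W = 5" "inj_on ?\<sigma> W"
    using a b by (auto simp: W_def)
  \<comment> \<open>At least 5 + 8 - 9 = 4 points of the path lie in \<open>V\<close>.\<close>
  have "card W + card V = card (W \<union> V) + card (W \<inter> V)"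
    using assms(1) by (intro card_Un_Int) (auto simp: W_def)
  moreover have "card (W \<union> V) \<le> 9"
    using card_mono[OF fin, of "W \<union> V"] W V \<open>card A = 3\<close> \<open>card B = 3\<close>
    by (simp add: card_cartesian_product)
  ultimately have "4 \<le> card (W \<inter> V)"
    using W assms by simp
  also have "\<dots> = card (?\<sigma> ` (W \<inter> V))"
    using W by (metis card_image inj_on_Int)
  also have "\<dots> \<le> card (?\<sigma> ` V)"
    using assms by (intro card_mono) auto
  finally show False
    using diag by simp
qed

section \<open>Tromino corners and the cells they force\<close>

definition corners :: "cell set \<Rightarrow> cell set" where
  "corners P = {v. v \<in> P \<and> v + (1, 0) \<in> P \<and> v + (0, 1) \<in> P}"

definition L_sumset :: "cell set \<Rightarrow> cell set" where
  "L_sumset V = V \<union> (+) (1, 0) ` V \<union> (+) (0, 1) ` V"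

lemma L_sumset_corners: "L_sumset (corners P) \<subseteq> P"
  by (auto simp: L_sumset_def corners_def add.commute)

lemma card_L_sumset_width:
  assumes "finite V"
  shows "card V + width (L_sumset V) \<le> card (L_sumset V)"
proof -
  have "(+) 0 ` V \<union> (+) (0, 1) ` V \<union> (+) (1, 0) ` V = L_sumset V"
    by (auto simp: L_sumset_def)
  then show ?thesis
    using card_sumset_fibres[of V fst 0 "(0, 1)" "(1, 0)"] assms
    by (simp add: width_def zero_prod_def)
qed

lemma card_L_sumset_height:
  assumes "finite V"
  shows "card V + height (L_sumset V) \<le> card (L_sumset V)"
proof -
  have "(+) 0 ` V \<union> (+) (1, 0) ` V \<union> (+) (0, 1) ` V = L_sumset V"
    by (auto simp: L_sumset_def)
  then show ?thesis
    using card_sumset_fibres[of V snd 0 "(1, 0)" "(0, 1)"] assms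
    by (simp add: height_def zero_prod_def)
qed

text \<open>Four lines of \<open>V\<close> in some direction become at least five lines of the
  sumset, and 8 + 5 = 13.\<close>

lemma card_L_sumset_ge:
  assumes fin: "finite V" and "8 \<le> card V"
  shows "13 \<le> card (L_sumset V)"
proof -
  let ?\<sigma> = "\<lambda>c::cell. fst c + snd c"
  have "V \<noteq> {}"
    using assms by auto
  \<comment> \<open>For columns, rows and antidiagonals in turn: the first two translations lie on a
    common line, the third on another.\<close>
  have S: "(+) 0 ` V \<union> (+) (0, 1) ` V \<union> (+) (1, 0) ` V = L_sumset V"
    "(+) 0 ` V \<union> (+) (1, 0) ` V \<union> (+) (0, 1) ` V = L_sumset V"
    "(+) (1, 0) ` V \<union> (+) (0, 1) ` V \<union> (+) 0 ` V = L_sumset V"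
    by (auto simp: L_sumset_def)
  have "card (fst ` V) < card (fst ` L_sumset V)"
    using card_sumset_projection[of V fst "(1, 0)" 0 "(0, 1)"] fin \<open>V \<noteq> {}\<close> S by simp
  moreover have "card (snd ` V) < card (snd ` L_sumset V)"
    using card_sumset_projection[of V snd "(0, 1)" 0 "(1, 0)"] fin \<open>V \<noteq> {}\<close> S by simp
  moreover have "card (?\<sigma> ` V) < card (?\<sigma> ` L_sumset V)"
    using card_sumset_projection[of V ?\<sigma> 0 "(1, 0)" "(0, 1)"] fin \<open>V \<noteq> {}\<close> S by simp
  moreover have "card V + card (?\<sigma> ` L_sumset V) \<le> card (L_sumset V)"
    using card_sumset_fibres[of V ?\<sigma> "(1, 0)" "(0, 1)" 0] fin S by simp
  ultimately show ?thesis
    using four_parallel_lines[OF assms] card_L_sumset_width[OF fin] card_L_sumset_height[OF fin]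
      assms(2)
    unfolding width_def height_def by linarith
qed

section \<open>Colored instances and the number of corners\<close>

lemma L_tromino_instance:
  "Q \<subseteq> P \<and> instance_with_coloring L_tromino g f Q \<longleftrightarrow>
     (\<exists>v\<in>corners P. Q = (+) v ` L_tromino \<and>
        f v = g (0, 0) \<and> f (v + (1, 0)) = g (1, 0) \<and> f (v + (0, 1)) = g (0, 1))"
proof -
  have zero: "v + (0, 0) = v" for v :: cell
    by (simp add: prod_eq_iff)
  have sub: "(+) v ` L_tromino \<subseteq> P \<longleftrightarrow> v \<in> corners P" for v
    by (simp add: L_tromino_def corners_def zero)
  have "(\<forall>c\<in>L_tromino. f (v + c) = g c) \<longleftrightarrow>
      f v = g (0, 0) \<and> f (v + (1, 0)) = g (1, 0) \<and> f (v + (0, 1)) = g (0, 1)" for v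
    by (simp add: L_tromino_def zero)
  then show ?thesis
    unfolding instance_with_coloring_def using sub by blast
qed

text \<open>Since every coloring has an instance, reading off the colors at each corner maps the
  corners onto all 2^3 colorings.\<close>

lemma card_corners_de_bruijn:
  assumes "de_bruijn_polyomino L_tromino 2 P f"
  shows "8 \<le> card (corners P)"
proof -
  define key where "key v = (\<lambda>c\<in>L_tromino. f (v + c))" for v
  have "finite P"
    using assms by (simp add: de_bruijn_polyomino_def polyomino_def)
  moreover have "corners P \<subseteq> P"
    by (auto simp: corners_def)
  ultimately have fin: "finite (corners P)"
    by (rule finite_subset[rotated])
  have zero: "v + (0, 0) = v" for v :: cell
    by (simp add: prod_eq_iff)
  have "colorings 2 L_tromino \<subseteq> key ` corners P"
  proof
    fix g assume g: "g \<in> colorings 2 L_tromino"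
    then obtain Q where "Q \<subseteq> P \<and> instance_with_coloring L_tromino g f Q"
      using assms unfolding de_bruijn_polyomino_def by blast
    then obtain v where v: "v \<in> corners P" "f v = g (0, 0)" "f (v + (1, 0)) = g (1, 0)"
      "f (v + (0, 1)) = g (0, 1)"
      unfolding L_tromino_instance by blast
    have "g = key v"
    proof
      fix c show "g c = key v c"
      proof (cases "c \<in> L_tromino")
        case True
        then have "c = (0, 0) \<or> c = (1, 0) \<or> c = (0, 1)"
          by (simp add: L_tromino_def)
        then have "f (v + c) = g c"
          using v zero by metis
        then show ?thesis
          using True by (simp add: key_def)
      next
        \<comment> \<open>Outside the tromino both functions are \<open>undefined\<close>:
          \<open>g\<close> is extensional and \<open>key v\<close> is a restriction.\<close>
        case False
        then show ?thesis
          using PiE_arb[OF g[unfolded colorings_def]] by (simp add: key_def)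
      qed
    qed
    then show "g \<in> key ` corners P"
      using v by blast
  qed
  then have "card (colorings 2 L_tromino) \<le> card (corners P)"
    using fin by (rule surj_card_le[rotated])
  moreover have "card (colorings 2 L_tromino) = 8"
    by (simp add: colorings_def L_tromino_def card_PiE)
  ultimately show ?thesis
    by simp
qed

section \<open>An explicit de Bruijn polyomino with 13 cells\<close>

lemma edge_connected_if_descending:
  assumes "\<forall>(x, y)\<in>A. 0 \<le> x \<and> 0 \<le> y"
    and "\<forall>(x, y)\<in>A. 0 < x \<longrightarrow> (x - 1, y) \<in> A"
    and "\<forall>(x, y)\<in>A. 0 < y \<longrightarrow> (x, y - 1) \<in> A"
  shows "edge_connected A"
proof -
  define R where "R u v \<longleftrightarrow> u \<in> A \<and> v \<in> A \<and> edge_adjacent u v" for u v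
  have "symp R"
    by (auto simp: symp_def R_def edge_adjacent_def abs_minus_commute)
  \<comment> \<open>Steps to the left or down stay in \<open>A\<close> and lower
    \<open>x + y\<close> until the origin is reached. By symmetry of \<open>R\<close>, any two cells
    are then joined through the origin.\<close>
  have origin: "R\<^sup>*\<^sup>* (x, y) (0, 0)" if "(x, y) \<in> A" for x y
    using that
  proof (induction "nat (x + y)" arbitrary: x y rule: less_induct)
    case less
    have nonneg: "0 \<le> x" "0 \<le> y"
      using bspec[OF assms(1) less.prems] by auto
    consider "0 < x" | "0 < y" | "x = 0" "y = 0"
      using nonneg by linarith
    then show ?case
    proof cases
      case 1
      have "R (x, y) (x - 1, y)"
        using bspec[OF assms(2) less.prems] 1 less.prems by (simp add: R_def edge_adjacent_def)
      moreover have "R\<^sup>*\<^sup>* (x - 1, y) (0, 0)"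
        using bspec[OF assms(2) less.prems] 1 nonneg by (intro less.hyps) auto
      ultimately show ?thesis
        by (rule converse_rtranclp_into_rtranclp)
    next
      case 2
      have "R (x, y) (x, y - 1)"
        using bspec[OF assms(3) less.prems] 2 less.prems by (simp add: R_def edge_adjacent_def)
      moreover have "R\<^sup>*\<^sup>* (x, y - 1) (0, 0)"
        using bspec[OF assms(3) less.prems] 2 nonneg by (intro less.hyps) auto
      ultimately show ?thesis
        by (rule converse_rtranclp_into_rtranclp)
    qed auto
  qed
  have "R\<^sup>*\<^sup>* a b" if "a \<in> A" "b \<in> A" for a b
  proof -
    have "R\<^sup>*\<^sup>* a (0, 0)" "R\<^sup>*\<^sup>* b (0, 0)"
      using origin[of "fst a" "snd a"] origin[of "fst b" "snd b"] that by simp_all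
    then show ?thesis
      by (meson \<open>symp R\<close> rtranclp_trans sympD symp_rtranclp)
  qed
  then show ?thesis
    by (simp add: edge_connected_def R_def [abs_def])
qed

text \<open>A Young diagram with columns of heights 4, 4, 3, 2, hence closed under steps to the left
  and down. It has exactly eight corners, one for each coloring.\<close>

definition staircase :: "cell set" where
  "staircase = {(0, 0), (0, 1), (0, 2), (0, 3), (1, 0), (1, 1), (1, 2), (1, 3),
     (2, 0), (2, 1), (2, 2), (3, 0), (3, 1)}"

text \<open>Found by computer search.\<close>

definition staircase_coloring :: "cell \<Rightarrow> nat" where
  "staircase_coloring = (\<lambda>c\<in>staircase.
     if c \<in> {(0, 0), (0, 1), (0, 3), (1, 0), (1, 1), (2, 2), (3, 1)} then 1 else 2)"

lemma corners_staircase: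
  "corners staircase = {(0, 0), (0, 1), (0, 2), (1, 0), (1, 1), (1, 2), (2, 0), (2, 1)}"
  (is "_ = ?C")
proof -
  define C where "C = ?C"
  have "\<forall>v\<in>staircase. v + (1, 0) \<in> staircase \<and> v + (0, 1) \<in> staircase \<longleftrightarrow> v \<in> C"
    by (simp add: staircase_def C_def zero_prod_def)
  moreover have "C \<subseteq> staircase"
    by (simp add: staircase_def C_def)
  ultimately have "corners staircase = C"
    unfolding corners_def by blast
  then show ?thesis
    by (simp only: C_def)
qed

lemma de_bruijn_staircase: "de_bruijn_polyomino L_tromino 2 staircase staircase_coloring"
proof -
  let ?f = staircase_coloring
  let ?key = "\<lambda>v. (?f v, ?f (v + (1, 0)), ?f (v + (0, 1)))"
  have "?key ` corners staircase = {(1, 1, 1), (1, 1, 2), (2, 2, 1), (1, 2, 1), (1, 2, 2),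
    (2, 1, 2), (2, 2, 2), (2, 1, 1)}"
    unfolding corners_staircase by (simp add: staircase_coloring_def staircase_def zero_prod_def)
  also have "\<dots> = {1, 2} \<times> {1, 2} \<times> {1, 2}"
    by auto
  finally have key: "?key ` corners staircase = {1, 2} \<times> {1, 2} \<times> {1, 2}" .
  \<comment> \<open>Eight corners map onto eight color triples, so no triple repeats; this yields
    the uniqueness of instances.\<close>
  have inj: "inj_on ?key (corners staircase)"
    by (rule eq_card_imp_inj_on)
      (simp_all add: key card_cartesian_product, simp_all add: corners_staircase)
  have "\<exists>!Q. Q \<subseteq> staircase \<and> instance_with_coloring L_tromino g ?f Q"
    if "g \<in> colorings 2 L_tromino" for g
  proof -
    have g: "g c \<in> {1, 2}" if "c \<in> L_tromino" for c
      using PiE_mem[OF \<open>g \<in> colorings 2 L_tromino\<close>[unfolded colorings_def] that] by auto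
    have "(g (0, 0), g (1, 0), g (0, 1)) \<in> {1, 2} \<times> {1, 2} \<times> {1, 2}"
      by (intro SigmaI g) (simp_all add: L_tromino_def)
    then obtain v where v: "v \<in> corners staircase" "?key v = (g (0, 0), g (1, 0), g (0, 1))"
      unfolding key[symmetric] by (metis (no_types, lifting) imageE)
    show ?thesis
      unfolding L_tromino_instance
    proof (rule ex1I[of _ "(+) v ` L_tromino"])
      show "\<exists>va\<in>corners staircase. (+) v ` L_tromino = (+) va ` L_tromino \<and>
        ?f va = g (0, 0) \<and> ?f (va + (1, 0)) = g (1, 0) \<and> ?f (va + (0, 1)) = g (0, 1)"
        using v by auto
    next
      fix Q
      assume "\<exists>v\<in>corners staircase. Q = (+) v ` L_tromino \<and>
        ?f v = g (0, 0) \<and> ?f (v + (1, 0)) = g (1, 0) \<and> ?f (v + (0, 1)) = g (0, 1)"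
      then obtain u where u: "u \<in> corners staircase" "Q = (+) u ` L_tromino"
        "?key u = (g (0, 0), g (1, 0), g (0, 1))"
        by auto
      then have "u = v"
        using v inj_onD[OF inj] by metis
      then show "Q = (+) v ` L_tromino"
        using u by simp
    qed
  qed
  moreover have "edge_connected staircase"
    by (rule edge_connected_if_descending) (simp_all add: staircase_def zero_prod_def)
  then have "polyomino staircase"
    by (simp add: polyomino_def staircase_def)
  moreover have "?f \<in> colorings 2 staircase"
    by (simp add: colorings_def staircase_coloring_def restrict_PiE_iff)
  ultimately show ?thesis
    by (simp add: de_bruijn_polyomino_def)
qed

theorem theorem7p5:
  fixes P :: "cell set" and f :: "cell \<Rightarrow> nat" and w h :: nat
  assumes "prismatic_polyomino L_tromino 2 P f"
    and "w = width P"
    and "h = height P"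
  shows "card P = 13 \<and> w \<le> 5 \<and> h \<le> 5"
proof -
  have P: "de_bruijn_polyomino L_tromino 2 P f"
    using assms(1) by (simp add: prismatic_polyomino_def)
  then have "finite P"
    by (simp add: de_bruijn_polyomino_def polyomino_def)
  define V where "V = corners P"
  have "finite V"
    using \<open>finite P\<close> by (rule rev_finite_subset) (auto simp: V_def corners_def)
  have V: "8 \<le> card V"
    using P by (simp add: V_def card_corners_de_bruijn)
  have ge: "13 \<le> card (L_sumset V)"
    using \<open>finite V\<close> V by (rule card_L_sumset_ge)
  have sub: "L_sumset V \<subseteq> P"
    unfolding V_def by (rule L_sumset_corners)
  have "card P \<le> card staircase"
    using assms(1) de_bruijn_staircase unfolding prismatic_polyomino_def by blast
  then have le: "card P \<le> 13"
    by (simp add: staircase_def)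
  have "P = L_sumset V"
    using card_seteq[OF \<open>finite P\<close> sub] le ge by simp
  \<comment> \<open>Now \<open>8 + w \<le> card V + w \<le> card P = 13\<close>, and likewise for
    \<open>h\<close>.\<close>
  then show ?thesis
    using card_L_sumset_width[OF \<open>finite V\<close>] card_L_sumset_height[OF \<open>finite V\<close>] V ge le assms
    by simp
qed

end
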